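(* With the functors $\mathcal{F}:\mathcal{R}_M\to\mathcal{T}$, $\mathcal{G}:\mathcal{T}_C\to\mathcal{R}$, $\mathcal{D}_R:\mathcal{R}_M\to\mathcal{R}$, $\mathcal{D}_T:\mathcal{T}_C\to\mathcal{T}$ given in the context, it holds that $$\mathcal{G}\circ\mathcal{F}=\mathcal{D}_R\qquad\text{and}\qquad\mathcal{F}\circ\mathcal{G}=\mathcal{D}_T,$$ where in the first composition a ternary rack $(X,T)$ is regarded as the object $(X,T,T)$ of $\mathcal{T}_C$, and in the second composition a rack $(Y,* )$ is regarded as the object $(Y,*,* )$ of $\mathcal{R}_M$ (both identifications being the identity on morphisms).
   Context: $\mathcal{R}$: category of racks (sets with a binary operation such that $(a*b)*c=(a*c)*(b*c)$ and all maps $x\mapsto x*y$ are bijections; morphisms preserve $*$). $\mathcal{T}$: category of ternary racks $(X,T)$ (ternary operations with $T(T(x,y,z),u,v)=T(T(x,u,v),T(y,u,v),T(z,u,v))$ and all maps $x\mapsto T(x,a,b)$ bijective; morphisms preserve $T$). $\mathcal{R}_M$: objects are $(X,*_0,*_1)$ where $*_0,*_1$ are rack operations on $X$ that are mutually distributive, i.e. $(x*_0y)*_1z=(x*_1z)*_0(y*_1z)$ and $(x*_1y)*_0z=(x*_0z)*_1(y*_0z)$ for all $x,y,z$; morphisms are maps that are rack morphisms for both pairs of operations. $\mathcal{T}_C$: objects are $(X,T_0,T_1)$ where $T_0,T_1$ are ternary rack operations on $X$ that are compatible, i.e. for all elements of $X$ $$T_0(T_0(x_0,y_0,y_1),z_0,z_1)=T_0(T_0(x_0,z_0,z_1),T_0(y_0,z_0,z_1),T_1(y_1,z_0,z_1)),$$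 $$T_1(T_1(x_1,y_0,y_1),z_0,z_1)=T_1(T_1(x_1,z_0,z_1),T_0(y_0,z_0,z_1),T_1(y_1,z_0,z_1));$$ morphisms are maps that are ternary rack morphisms for both pairs of operations. Functors: - $\mathcal{F}(X,*_0,*_1)=(X,T)$ with $T(x,y,z)=(x*_0y)*_1z$, and $\mathcal{F}(f)=f$. - $\mathcal{G}(X,T_0,T_1)=(X\times X,* )$ with $(x_0,x_1)*(y_0,y_1)=(T_0(x_0,y_0,y_1),T_1(x_1,y_0,y_1))$, and $\mathcal{G}(f)=f\times f$. - $\mathcal{D}_R(X,*_0,*_1)=(X\times X,* )$ with $(x_0,x_1)*(y_0,y_1)=((x_0*_0y_0)*_1y_1,(x_1*_0y_0)*_1y_1)$, and $\mathcal{D}_R(f)=f\times f$. - $\mathcal{D}_T(X,T_0,T_1)=(X\times X,T)$ with $T((x_0,x_1),(y_0,y_1),(z_0,z_1))=(T_0(T_0(x_0,y_0,y_1),z_0,z_1),T_1(T_1(x_1,y_0,y_1),z_0,z_1))$, and $\mathcal{D}_T(f)=f\times f$. *)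

theory Defs
  imports "HOL-Library.FuncSet"
begin

section \<open>Categories and functors\<close>

record ('o, 'm) category =
  Obj :: "'o set"
  Arr :: "'m set"
  Dom :: "'m \<Rightarrow> 'o"
  Cod :: "'m \<Rightarrow> 'o"
  Ident :: "'o \<Rightarrow> 'm"
  Comp :: "'m \<Rightarrow> 'm \<Rightarrow> 'm"

definition is_category :: "('o, 'm) category \<Rightarrow> bool" where
  "is_category C \<longleftrightarrow>
     (\<forall>f\<in>Arr C. Dom C f \<in> Obj C \<and> Cod C f \<in> Obj C) \<and>
     (\<forall>X\<in>Obj C. Ident C X \<in> Arr C \<and> Dom C (Ident C X) = X \<and> Cod C (Ident C X) = X) \<and>
     (\<forall>f\<in>Arr C. \<forall>g\<in>Arr C. Cod C f = Dom C g \<longrightarrow>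
        Comp C g f \<in> Arr C \<and> Dom C (Comp C g f) = Dom C f \<and> Cod C (Comp C g f) = Cod C g) \<and>
     (\<forall>f\<in>Arr C. Comp C f (Ident C (Dom C f)) = f \<and> Comp C (Ident C (Cod C f)) f = f) \<and>
     (\<forall>f\<in>Arr C. \<forall>g\<in>Arr C. \<forall>h\<in>Arr C. Cod C f = Dom C g \<and> Cod C g = Dom C h \<longrightarrow>
        Comp C h (Comp C g f) = Comp C (Comp C h g) f)"

text \<open>The object and arrow maps of a functor are normalised to be undefined outside the
  objects and arrows of its source, so that equality of these records is equality of functors:
  same source, same target, same values on objects and on arrows.\<close>

record ('o, 'm, 'p, 'n) cfunctor =
  Source :: "('o, 'm) category"
  Target :: "('p, 'n) category"
  omap :: "'o \<Rightarrow> 'p"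
  amap :: "'m \<Rightarrow> 'n"

definition mk_functor ::
  "('o, 'm) category \<Rightarrow> ('p, 'n) category \<Rightarrow> ('o \<Rightarrow> 'p) \<Rightarrow> ('m \<Rightarrow> 'n) \<Rightarrow> ('o, 'm, 'p, 'n) cfunctor"
  where
  "mk_functor C D Fo Fa =
     \<lparr>Source = C, Target = D, omap = restrict Fo (Obj C), amap = restrict Fa (Arr C)\<rparr>"

definition is_functor ::
  "('o, 'm) category \<Rightarrow> ('p, 'n) category \<Rightarrow> ('o, 'm, 'p, 'n) cfunctor \<Rightarrow> bool" where
  "is_functor C D F \<longleftrightarrow>
     is_category C \<and> is_category D \<and> Source F = C \<and> Target F = D \<and>
     omap F \<in> Obj C \<rightarrow>\<^sub>E Obj D \<and> amap F \<in> Arr C \<rightarrow>\<^sub>E Arr D \<and>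
     (\<forall>f\<in>Arr C. Dom D (amap F f) = omap F (Dom C f) \<and> Cod D (amap F f) = omap F (Cod C f)) \<and>
     (\<forall>X\<in>Obj C. amap F (Ident C X) = Ident D (omap F X)) \<and>
     (\<forall>f\<in>Arr C. \<forall>g\<in>Arr C. Cod C f = Dom C g \<longrightarrow>
        amap F (Comp C g f) = Comp D (amap F g) (amap F f))"

definition functor_comp ::
  "('p, 'n, 'q, 'l) cfunctor \<Rightarrow> ('o, 'm, 'p, 'n) cfunctor \<Rightarrow> ('o, 'm, 'q, 'l) cfunctor"
  (infixl "\<circ>\<^sub>F" 55) where
  "G \<circ>\<^sub>F F = mk_functor (Source F) (Target G) (omap G \<circ> omap F) (amap G \<circ> amap F)"


section \<open>Racks and ternary racks\<close>

text \<open>A structure on a set is a tuple whose first component is the carrier \<open>X\<close>; operations are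
  functions \<open>X \<times> X \<rightarrow> X\<close> or \<open>X \<times> X \<times> X \<rightarrow> X\<close>, undefined outside their domain, so that equality of
  tuples is equality of structures. The carrier may be empty.\<close>

type_synonym 'a bin = "'a \<times> 'a \<Rightarrow> 'a"
type_synonym 'a tern = "'a \<times> 'a \<times> 'a \<Rightarrow> 'a"

fun is_rack :: "'a set \<times> 'a bin \<Rightarrow> bool" where
  "is_rack (X, m) \<longleftrightarrow>
     m \<in> X \<times> X \<rightarrow>\<^sub>E X \<and>
     (\<forall>a\<in>X. \<forall>b\<in>X. \<forall>c\<in>X. m (m (a, b), c) = m (m (a, c), m (b, c))) \<and>
     (\<forall>y\<in>X. bij_betw (\<lambda>x. m (x, y)) X X)"

fun rack_hom :: "'a set \<times> 'a bin \<Rightarrow> 'a set \<times> 'a bin \<Rightarrow> ('a \<Rightarrow> 'a) \<Rightarrow> bool" where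
  "rack_hom (X, m) (Y, n) f \<longleftrightarrow>
     f \<in> X \<rightarrow>\<^sub>E Y \<and> (\<forall>a\<in>X. \<forall>b\<in>X. f (m (a, b)) = n (f a, f b))"

fun is_ternary_rack :: "'a set \<times> 'a tern \<Rightarrow> bool" where
  "is_ternary_rack (X, T) \<longleftrightarrow>
     T \<in> X \<times> X \<times> X \<rightarrow>\<^sub>E X \<and>
     (\<forall>x\<in>X. \<forall>y\<in>X. \<forall>z\<in>X. \<forall>u\<in>X. \<forall>v\<in>X.
        T (T (x, y, z), u, v) = T (T (x, u, v), T (y, u, v), T (z, u, v))) \<and>
     (\<forall>a\<in>X. \<forall>b\<in>X. bij_betw (\<lambda>x. T (x, a, b)) X X)"

fun ternary_rack_hom :: "'a set \<times> 'a tern \<Rightarrow> 'a set \<times> 'a tern \<Rightarrow> ('a \<Rightarrow> 'a) \<Rightarrow> bool" where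
  "ternary_rack_hom (X, T) (Y, U) f \<longleftrightarrow>
     f \<in> X \<rightarrow>\<^sub>E Y \<and> (\<forall>a\<in>X. \<forall>b\<in>X. \<forall>c\<in>X. f (T (a, b, c)) = U (f a, f b, f c))"

fun is_mutual_rack :: "'a set \<times> 'a bin \<times> 'a bin \<Rightarrow> bool" where
  "is_mutual_rack (X, m0, m1) \<longleftrightarrow>
     is_rack (X, m0) \<and> is_rack (X, m1) \<and>
     (\<forall>x\<in>X. \<forall>y\<in>X. \<forall>z\<in>X. m1 (m0 (x, y), z) = m0 (m1 (x, z), m1 (y, z))) \<and>
     (\<forall>x\<in>X. \<forall>y\<in>X. \<forall>z\<in>X. m0 (m1 (x, y), z) = m1 (m0 (x, z), m0 (y, z)))"

fun mutual_rack_hom ::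
  "'a set \<times> 'a bin \<times> 'a bin \<Rightarrow> 'a set \<times> 'a bin \<times> 'a bin \<Rightarrow> ('a \<Rightarrow> 'a) \<Rightarrow> bool" where
  "mutual_rack_hom (X, m0, m1) (Y, n0, n1) f \<longleftrightarrow>
     rack_hom (X, m0) (Y, n0) f \<and> rack_hom (X, m1) (Y, n1) f"

fun is_compatible_ternary_rack :: "'a set \<times> 'a tern \<times> 'a tern \<Rightarrow> bool" where
  "is_compatible_ternary_rack (X, T0, T1) \<longleftrightarrow>
     is_ternary_rack (X, T0) \<and> is_ternary_rack (X, T1) \<and>
     (\<forall>x0\<in>X. \<forall>y0\<in>X. \<forall>y1\<in>X. \<forall>z0\<in>X. \<forall>z1\<in>X.
        T0 (T0 (x0, y0, y1), z0, z1) = T0 (T0 (x0, z0, z1), T0 (y0, z0, z1), T1 (y1, z0, z1))) \<and>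
     (\<forall>x1\<in>X. \<forall>y0\<in>X. \<forall>y1\<in>X. \<forall>z0\<in>X. \<forall>z1\<in>X.
        T1 (T1 (x1, y0, y1), z0, z1) = T1 (T1 (x1, z0, z1), T0 (y0, z0, z1), T1 (y1, z0, z1)))"

fun compatible_ternary_rack_hom ::
  "'a set \<times> 'a tern \<times> 'a tern \<Rightarrow> 'a set \<times> 'a tern \<times> 'a tern \<Rightarrow> ('a \<Rightarrow> 'a) \<Rightarrow> bool" where
  "compatible_ternary_rack_hom (X, T0, T1) (Y, U0, U1) f \<longleftrightarrow>
     ternary_rack_hom (X, T0) (Y, U0) f \<and> ternary_rack_hom (X, T1) (Y, U1) f"


section \<open>The four categories\<close>

text \<open>Objects of type \<open>'a set \<times> 's\<close> with underlying set the first component; an arrow is a triple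
  \<open>(A, B, f)\<close> of its domain, its codomain and the underlying map.\<close>

type_synonym ('a, 's) arr = "('a set \<times> 's) \<times> ('a set \<times> 's) \<times> ('a \<Rightarrow> 'a)"

definition concrete_category ::
  "('a set \<times> 's \<Rightarrow> bool) \<Rightarrow> ('a set \<times> 's \<Rightarrow> 'a set \<times> 's \<Rightarrow> ('a \<Rightarrow> 'a) \<Rightarrow> bool) \<Rightarrow>
     ('a set \<times> 's, ('a, 's) arr) category" where
  "concrete_category ob hom =
     \<lparr>Obj = {A. ob A},
      Arr = {(A, B, f). ob A \<and> ob B \<and> hom A B f},
      Dom = (\<lambda>(A, B, f). A),
      Cod = (\<lambda>(A, B, f). B),
      Ident = (\<lambda>A. (A, A, \<lambda>x\<in>fst A. x)),
      Comp = (\<lambda>(B', C, g) (A, B, f). (A, C, compose (fst A) g f))\<rparr>"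

definition cat_R :: "('a set \<times> 'a bin, ('a, 'a bin) arr) category" where
  "cat_R = concrete_category is_rack rack_hom"

definition cat_T :: "('a set \<times> 'a tern, ('a, 'a tern) arr) category" where
  "cat_T = concrete_category is_ternary_rack ternary_rack_hom"

definition cat_RM :: "('a set \<times> 'a bin \<times> 'a bin, ('a, 'a bin \<times> 'a bin) arr) category" where
  "cat_RM = concrete_category is_mutual_rack mutual_rack_hom"

definition cat_TC :: "('a set \<times> 'a tern \<times> 'a tern, ('a, 'a tern \<times> 'a tern) arr) category" where
  "cat_TC = concrete_category is_compatible_ternary_rack compatible_ternary_rack_hom"


section \<open>The functors\<close>

text \<open>The action on arrows of a functor that keeps underlying maps, respectively sends an
  underlying map \<open>f\<close> to \<open>f \<times> f\<close>.\<close>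

definition arr_same :: "('a set \<times> 's \<Rightarrow> 'a set \<times> 't) \<Rightarrow> ('a, 's) arr \<Rightarrow> ('a, 't) arr" where
  "arr_same Fo = (\<lambda>(A, B, f). (Fo A, Fo B, f))"

definition arr_square ::
  "('a set \<times> 's \<Rightarrow> ('a \<times> 'a) set \<times> 't) \<Rightarrow> ('a, 's) arr \<Rightarrow> ('a \<times> 'a, 't) arr" where
  "arr_square Fo = (\<lambda>(A, B, f). (Fo A, Fo B, restrict (map_prod f f) (fst A \<times> fst A)))"

fun F_obj :: "'a set \<times> 'a bin \<times> 'a bin \<Rightarrow> 'a set \<times> 'a tern" where
  "F_obj (X, m0, m1) = (X, \<lambda>(x, y, z)\<in>X \<times> X \<times> X. m1 (m0 (x, y), z))"

fun G_obj :: "'a set \<times> 'a tern \<times> 'a tern \<Rightarrow> ('a \<times> 'a) set \<times> ('a \<times> 'a) bin" where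
  "G_obj (X, T0, T1) =
     (X \<times> X, \<lambda>((x0, x1), (y0, y1))\<in>(X \<times> X) \<times> (X \<times> X). (T0 (x0, y0, y1), T1 (x1, y0, y1)))"

fun DR_obj :: "'a set \<times> 'a bin \<times> 'a bin \<Rightarrow> ('a \<times> 'a) set \<times> ('a \<times> 'a) bin" where
  "DR_obj (X, m0, m1) =
     (X \<times> X, \<lambda>((x0, x1), (y0, y1))\<in>(X \<times> X) \<times> (X \<times> X).
        (m1 (m0 (x0, y0), y1), m1 (m0 (x1, y0), y1)))"

fun DT_obj :: "'a set \<times> 'a tern \<times> 'a tern \<Rightarrow> ('a \<times> 'a) set \<times> ('a \<times> 'a) tern" where
  "DT_obj (X, T0, T1) =
     (X \<times> X, \<lambda>((x0, x1), (y0, y1), (z0, z1))\<in>(X \<times> X) \<times> (X \<times> X) \<times> (X \<times> X).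
        (T0 (T0 (x0, y0, y1), z0, z1), T1 (T1 (x1, y0, y1), z0, z1)))"

fun double_op :: "'a set \<times> 's \<Rightarrow> 'a set \<times> 's \<times> 's" where
  "double_op (X, m) = (X, m, m)"

definition functor_F ::
  "('a set \<times> 'a bin \<times> 'a bin, ('a, 'a bin \<times> 'a bin) arr, 'a set \<times> 'a tern, ('a, 'a tern) arr) cfunctor"
  where "functor_F = mk_functor cat_RM cat_T F_obj (arr_same F_obj)"

definition functor_G ::
  "('a set \<times> 'a tern \<times> 'a tern, ('a, 'a tern \<times> 'a tern) arr,
    ('a \<times> 'a) set \<times> ('a \<times> 'a) bin, ('a \<times> 'a, ('a \<times> 'a) bin) arr) cfunctor"
  where "functor_G = mk_functor cat_TC cat_R G_obj (arr_square G_obj)"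

definition functor_DR ::
  "('a set \<times> 'a bin \<times> 'a bin, ('a, 'a bin \<times> 'a bin) arr,
    ('a \<times> 'a) set \<times> ('a \<times> 'a) bin, ('a \<times> 'a, ('a \<times> 'a) bin) arr) cfunctor"
  where "functor_DR = mk_functor cat_RM cat_R DR_obj (arr_square DR_obj)"

definition functor_DT ::
  "('a set \<times> 'a tern \<times> 'a tern, ('a, 'a tern \<times> 'a tern) arr,
    ('a \<times> 'a) set \<times> ('a \<times> 'a) tern, ('a \<times> 'a, ('a \<times> 'a) tern) arr) cfunctor"
  where "functor_DT = mk_functor cat_TC cat_T DT_obj (arr_square DT_obj)"

text \<open>The identifications \<open>(X, T) \<mapsto> (X, T, T)\<close> and \<open>(X, m) \<mapsto> (X, m, m)\<close>.\<close>

definition double_T ::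
  "('a set \<times> 'a tern, ('a, 'a tern) arr, 'a set \<times> 'a tern \<times> 'a tern, ('a, 'a tern \<times> 'a tern) arr) cfunctor"
  where "double_T = mk_functor cat_T cat_TC double_op (arr_same double_op)"

definition double_R ::
  "('a set \<times> 'a bin, ('a, 'a bin) arr, 'a set \<times> 'a bin \<times> 'a bin, ('a, 'a bin \<times> 'a bin) arr) cfunctor"
  where "double_R = mk_functor cat_R cat_RM double_op (arr_same double_op)"


section \<open>Well-definedness\<close>

lemma is_category_concrete:
  assumes map: "\<And>A B f. ob A \<Longrightarrow> ob B \<Longrightarrow> hom A B f \<Longrightarrow> f \<in> fst A \<rightarrow>\<^sub>E fst B"
    and id: "\<And>A. ob A \<Longrightarrow> hom A A (\<lambda>x\<in>fst A. x)"
    and cmp: "\<And>A B C f g. ob A \<Longrightarrow> ob B \<Longrightarrow> ob C \<Longrightarrow> hom A B f \<Longrightarrow> hom B C g \<Longrightarrow>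
      hom A C (compose (fst A) g f)"
  shows "is_category (concrete_category ob hom)"
proof -
  have l: "compose (fst A) f (\<lambda>x\<in>fst A. x) = f" and r: "compose (fst A) (\<lambda>x\<in>fst B. x) f = f"
    if "ob A" "ob B" "hom A B f" for A B f
    using map[OF that] by (auto simp: compose_def fun_eq_iff PiE_def extensional_def)
  have as: "compose (fst A) h (compose (fst A) g f) = compose (fst A) (compose (fst B) h g) f"
    if "ob A" "ob B" "hom A B f" for A B f and g h :: "'a \<Rightarrow> 'a"
    using map[OF that] by (auto simp: compose_def fun_eq_iff PiE_def)
  note pair =
    cmp[where A = "(a, b)" for a b, unfolded fst_conv]
    l[where A = "(a, b)" for a b, unfolded fst_conv]
    r[where A = "(a, b)" and B = "(c, d)" for a b c d, unfolded fst_conv]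
    as[where A = "(a, b)" and B = "(c, d)" for a b c d, unfolded fst_conv]
  show ?thesis
    unfolding is_category_def concrete_category_def
    by (intro conjI ballI impI; clarsimp simp: id; (rule pair; assumption))
qed

lemma bin_closed: "is_rack (X, m) \<Longrightarrow> a \<in> X \<Longrightarrow> b \<in> X \<Longrightarrow> m (a, b) \<in> X"
  by auto

lemma tern_closed:
  "is_ternary_rack (X, T) \<Longrightarrow> a \<in> X \<Longrightarrow> b \<in> X \<Longrightarrow> c \<in> X \<Longrightarrow> T (a, b, c) \<in> X"
  by auto

lemma hom_id:
  "is_rack A \<Longrightarrow> rack_hom A A (\<lambda>x\<in>fst A. x)"
  "is_ternary_rack B \<Longrightarrow> ternary_rack_hom B B (\<lambda>x\<in>fst B. x)"
proof -
  show "rack_hom A A (\<lambda>x\<in>fst A. x)" if "is_rack A"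
  proof -
    obtain X m where e: "A = (X, m)" by (metis prod.exhaust)
    have "m (a, b) \<in> X" if "a \<in> X" "b \<in> X" for a b
      using bin_closed[of X m a b] \<open>is_rack A\<close> that unfolding e by blast
    then show ?thesis by (simp add: e)
  qed
  show "ternary_rack_hom B B (\<lambda>x\<in>fst B. x)" if "is_ternary_rack B"
  proof -
    obtain X m where e: "B = (X, m)" by (metis prod.exhaust)
    have "m (a, b, c) \<in> X" if "a \<in> X" "b \<in> X" "c \<in> X" for a b c
      using tern_closed[of X m a b c] \<open>is_ternary_rack B\<close> that unfolding e by blast
    then show ?thesis by (simp add: e)
  qed
qed

lemma hom_comp:
  "is_rack A \<Longrightarrow> rack_hom A B f \<Longrightarrow> rack_hom B C g \<Longrightarrow> rack_hom A C (compose (fst A) g f)"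
  "is_ternary_rack A' \<Longrightarrow> ternary_rack_hom A' B' f \<Longrightarrow> ternary_rack_hom B' C' g \<Longrightarrow>
     ternary_rack_hom A' C' (compose (fst A') g f)"
proof -
  show "rack_hom A C (compose (fst A) g f)" if "is_rack A" "rack_hom A B f" "rack_hom B C g"
  proof -
    obtain X m Y n Z p where e: "A = (X, m)" "B = (Y, n)" "C = (Z, p)"
      by (metis prod.exhaust)
    have "m (a, b) \<in> X" if "a \<in> X" "b \<in> X" for a b
      using bin_closed[of X m a b] \<open>is_rack A\<close> that unfolding e by blast
    moreover have "f x \<in> Y" "y \<in> Y \<Longrightarrow> g y \<in> Z" if "x \<in> X" for x y
      using \<open>rack_hom A B f\<close> \<open>rack_hom B C g\<close> that by (auto simp: e)
    moreover have "f (m (a, b)) = n (f a, f b)" if "a \<in> X" "b \<in> X" for a b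
      using \<open>rack_hom A B f\<close> that by (simp add: e)
    moreover have "g (n (a, b)) = p (g a, g b)" if "a \<in> Y" "b \<in> Y" for a b
      using \<open>rack_hom B C g\<close> that by (simp add: e)
    ultimately show ?thesis by (simp add: e compose_def)
  qed
  show "ternary_rack_hom A' C' (compose (fst A') g f)"
    if "is_ternary_rack A'" "ternary_rack_hom A' B' f" "ternary_rack_hom B' C' g"
  proof -
    obtain X m Y n Z p where e: "A' = (X, m)" "B' = (Y, n)" "C' = (Z, p)"
      by (metis prod.exhaust)
    have "m (a, b, c) \<in> X" if "a \<in> X" "b \<in> X" "c \<in> X" for a b c
      using tern_closed[of X m a b c] \<open>is_ternary_rack A'\<close> that unfolding e by blast
    moreover have "f x \<in> Y" "y \<in> Y \<Longrightarrow> g y \<in> Z" if "x \<in> X" for x y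
      using \<open>ternary_rack_hom A' B' f\<close> \<open>ternary_rack_hom B' C' g\<close> that by (auto simp: e)
    moreover have "f (m (a, b, c)) = n (f a, f b, f c)" if "a \<in> X" "b \<in> X" "c \<in> X" for a b c
      using \<open>ternary_rack_hom A' B' f\<close> that by (simp add: e)
    moreover have "g (n (a, b, c)) = p (g a, g b, g c)" if "a \<in> Y" "b \<in> Y" "c \<in> Y" for a b c
      using \<open>ternary_rack_hom B' C' g\<close> that by (simp add: e)
    ultimately show ?thesis by (simp add: e compose_def)
  qed
qed

lemma hom_map:
  "rack_hom A B f \<Longrightarrow> f \<in> fst A \<rightarrow>\<^sub>E fst B"
  "ternary_rack_hom A' B' f \<Longrightarrow> f \<in> fst A' \<rightarrow>\<^sub>E fst B'"
  by (cases A; cases B; simp) (cases A'; cases B'; simp)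

lemma is_category_R: "is_category cat_R"
  unfolding cat_R_def by (rule is_category_concrete; (erule hom_map | erule hom_id | (erule (2) hom_comp)))

lemma is_category_T: "is_category cat_T"
  unfolding cat_T_def by (rule is_category_concrete; (erule hom_map | erule hom_id | (erule (2) hom_comp)))

lemma is_category_RM: "is_category cat_RM"
  unfolding cat_RM_def
proof (rule is_category_concrete)
  fix A B C :: "'a set \<times> 'a bin \<times> 'a bin" and f g
  obtain X m0 m1 Y n0 n1 Z p0 p1 where e: "A = (X, m0, m1)" "B = (Y, n0, n1)" "C = (Z, p0, p1)"
    by (metis prod.exhaust)
  show "f \<in> fst A \<rightarrow>\<^sub>E fst B" if "mutual_rack_hom A B f"
    using that hom_map(1)[of "(X, m0)" "(Y, n0)" f] by (simp add: e)
  show "mutual_rack_hom A A (\<lambda>x\<in>fst A. x)" if "is_mutual_rack A"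
    using that hom_id(1)[of "(X, m0)"] hom_id(1)[of "(X, m1)"]
    by (simp add: e del: is_rack.simps rack_hom.simps)
  show "mutual_rack_hom A C (compose (fst A) g f)"
    if "is_mutual_rack A" "mutual_rack_hom A B f" "mutual_rack_hom B C g"
    using that hom_comp(1)[of "(X, m0)" "(Y, n0)" f "(Z, p0)" g]
      hom_comp(1)[of "(X, m1)" "(Y, n1)" f "(Z, p1)" g]
    by (simp add: e del: is_rack.simps rack_hom.simps)
qed

lemma is_category_TC: "is_category cat_TC"
  unfolding cat_TC_def
proof (rule is_category_concrete)
  fix A B C :: "'a set \<times> 'a tern \<times> 'a tern" and f g
  obtain X m0 m1 Y n0 n1 Z p0 p1 where e: "A = (X, m0, m1)" "B = (Y, n0, n1)" "C = (Z, p0, p1)"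
    by (metis prod.exhaust)
  show "f \<in> fst A \<rightarrow>\<^sub>E fst B" if "compatible_ternary_rack_hom A B f"
    using that hom_map(2)[of "(X, m0)" "(Y, n0)" f] by (simp add: e)
  show "compatible_ternary_rack_hom A A (\<lambda>x\<in>fst A. x)" if "is_compatible_ternary_rack A"
    using that hom_id(2)[of "(X, m0)"] hom_id(2)[of "(X, m1)"]
    by (simp add: e del: is_ternary_rack.simps ternary_rack_hom.simps)
  show "compatible_ternary_rack_hom A C (compose (fst A) g f)"
    if "is_compatible_ternary_rack A" "compatible_ternary_rack_hom A B f"
      "compatible_ternary_rack_hom B C g"
    using that hom_comp(2)[of "(X, m0)" "(Y, n0)" f "(Z, p0)" g]
      hom_comp(2)[of "(X, m1)" "(Y, n1)" f "(Z, p1)" g]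
    by (simp add: e del: is_ternary_rack.simps ternary_rack_hom.simps)
qed

lemma is_functor_same:
  assumes C: "is_category (concrete_category ob hom)" "is_category (concrete_category ob' hom')"
    and Fo: "\<And>A. fst (Fo A) = fst A" "\<And>A. ob A \<Longrightarrow> ob' (Fo A)"
    and hom: "\<And>A B f. ob A \<Longrightarrow> ob B \<Longrightarrow> hom A B f \<Longrightarrow> hom' (Fo A) (Fo B) f"
  shows "is_functor (concrete_category ob hom) (concrete_category ob' hom')
    (mk_functor (concrete_category ob hom) (concrete_category ob' hom') Fo (arr_same Fo))"
  unfolding is_functor_def
proof (intro conjI C)
  let ?C = "concrete_category ob hom" and ?D = "concrete_category ob' hom'"
  let ?F = "mk_functor ?C ?D Fo (arr_same Fo)"
  have am: "amap ?F f = arr_same Fo f" if "f \<in> Arr ?C" for f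
    using that by (simp add: mk_functor_def)
  have om: "omap ?F A = Fo A" if "A \<in> Obj ?C" for A
    using that by (simp add: mk_functor_def)
  have ident: "Ident ?C A \<in> Arr ?C" if "A \<in> Obj ?C" for A
    using C(1) that unfolding is_category_def by blast
  have cmp: "Comp ?C g f \<in> Arr ?C" if "f \<in> Arr ?C" "g \<in> Arr ?C" "Cod ?C f = Dom ?C g" for f g
    using C(1) that unfolding is_category_def by blast
  show "\<forall>A\<in>Obj ?C. amap ?F (Ident ?C A) = Ident ?D (omap ?F A)"
    by (intro ballI, simp only: am[OF ident] om)
      (simp add: concrete_category_def arr_same_def Fo)
  show "\<forall>f\<in>Arr ?C. \<forall>g\<in>Arr ?C. Cod ?C f = Dom ?C g \<longrightarrow>
     amap ?F (Comp ?C g f) = Comp ?D (amap ?F g) (amap ?F f)"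
    by (intro ballI impI, simp only: am am[OF cmp])
      (auto simp: concrete_category_def arr_same_def Fo)
qed (use Fo hom in \<open>auto simp: mk_functor_def concrete_category_def arr_same_def\<close>)

lemma is_functor_square:
  assumes C: "is_category (concrete_category ob hom)" "is_category (concrete_category ob' hom')"
    and map: "\<And>A B f. ob A \<Longrightarrow> ob B \<Longrightarrow> hom A B f \<Longrightarrow> f \<in> fst A \<rightarrow>\<^sub>E fst B"
    and Fo: "\<And>A. fst (Fo A) = fst A \<times> fst A" "\<And>A. ob A \<Longrightarrow> ob' (Fo A)"
    and hom: "\<And>A B f. ob A \<Longrightarrow> ob B \<Longrightarrow> hom A B f \<Longrightarrow>
      hom' (Fo A) (Fo B) (restrict (map_prod f f) (fst A \<times> fst A))"
  shows "is_functor (concrete_category ob hom) (concrete_category ob' hom')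
    (mk_functor (concrete_category ob hom) (concrete_category ob' hom') Fo (arr_square Fo))"
  unfolding is_functor_def
proof (intro conjI C)
  let ?C = "concrete_category ob hom" and ?D = "concrete_category ob' hom'"
  let ?F = "mk_functor ?C ?D Fo (arr_square Fo)"
  have am: "amap ?F f = arr_square Fo f" if "f \<in> Arr ?C" for f
    using that by (simp add: mk_functor_def)
  have om: "omap ?F A = Fo A" if "A \<in> Obj ?C" for A
    using that by (simp add: mk_functor_def)
  have ident: "Ident ?C A \<in> Arr ?C" if "A \<in> Obj ?C" for A
    using C(1) that unfolding is_category_def by blast
  have cmp: "Comp ?C g f \<in> Arr ?C" if "f \<in> Arr ?C" "g \<in> Arr ?C" "Cod ?C f = Dom ?C g" for f g
    using C(1) that unfolding is_category_def by blast
  have sq: "restrict (map_prod (compose (fst A) g f) (compose (fst A) g f)) (fst A \<times> fst A) =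
      compose (fst A \<times> fst A) (restrict (map_prod g g) (fst B \<times> fst B))
        (restrict (map_prod f f) (fst A \<times> fst A))" if "ob A" "ob B" "hom A B f" for A B f and g :: "'a \<Rightarrow> 'a"
    using map[OF that] by (auto simp: fun_eq_iff compose_def PiE_def Pi_def)
  note sq' = sq[of "(a, b)" "(c, d)" for a b c d, unfolded fst_conv]
  show "\<forall>A\<in>Obj ?C. amap ?F (Ident ?C A) = Ident ?D (omap ?F A)"
    by (intro ballI, simp only: am[OF ident] om)
      (auto simp: concrete_category_def arr_square_def Fo fun_eq_iff)
  show "\<forall>f\<in>Arr ?C. \<forall>g\<in>Arr ?C. Cod ?C f = Dom ?C g \<longrightarrow>
     amap ?F (Comp ?C g f) = Comp ?D (amap ?F g) (amap ?F f)"
    by (intro ballI impI, simp only: am am[OF cmp])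
      (clarsimp simp: concrete_category_def arr_square_def Fo; rule sq'; assumption)
qed (use Fo hom in \<open>auto simp: mk_functor_def concrete_category_def arr_square_def\<close>)

lemma bij_betw_square:
  assumes "bij_betw f X X" "bij_betw g X X"
    and "\<And>x0 x1. x0 \<in> X \<Longrightarrow> x1 \<in> X \<Longrightarrow> h (x0, x1) = (f x0, g x1)"
  shows "bij_betw h (X \<times> X) (X \<times> X)"
proof -
  have "bij_betw (map_prod f g) (X \<times> X) (X \<times> X)"
    using assms(1,2) by (rule bij_betw_map_prod)
  then show ?thesis
    by (rule bij_betw_cong[THEN iffD1, rotated]) (auto simp: assms(3))
qed

lemma is_functor_F: "is_functor cat_RM cat_T functor_F"
  unfolding functor_F_def cat_RM_def cat_T_def
proof (rule is_functor_same)
  fix A B :: "'a set \<times> 'a bin \<times> 'a bin" and f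
  obtain X m0 m1 Y n0 n1 where e: "A = (X, m0, m1)" "B = (Y, n0, n1)"
    by (metis prod.exhaust)
  show "fst (F_obj A) = fst A" by (simp add: e)
  show "is_ternary_rack (F_obj A)" if a: "is_mutual_rack A"
  proof -
    have c: "m0 (a, b) \<in> X" "m1 (a, b) \<in> X" if "a \<in> X" "b \<in> X" for a b
      using a that by (auto simp: e)
    have b: "bij_betw (\<lambda>x. m1 (m0 (x, a), b)) X X" if "a \<in> X" "b \<in> X" for a b
      using a that bij_betw_trans[of "\<lambda>x. m0 (x, a)" X X "\<lambda>x. m1 (x, b)" X] by (simp add: e o_def)
    have bij: "bij_betw (\<lambda>x. (\<lambda>(x, y, z)\<in>X \<times> X \<times> X. m1 (m0 (x, y), z)) (x, a, b)) X X"
      if "a \<in> X" "b \<in> X" for a b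
      using b[OF that] by (rule bij_betw_cong[THEN iffD1, rotated]) (simp add: that)
    have d: "\<And>x y z. x \<in> X \<Longrightarrow> y \<in> X \<Longrightarrow> z \<in> X \<Longrightarrow> m0 (m0 (x, y), z) = m0 (m0 (x, z), m0 (y, z))"
      "\<And>x y z. x \<in> X \<Longrightarrow> y \<in> X \<Longrightarrow> z \<in> X \<Longrightarrow> m1 (m1 (x, y), z) = m1 (m1 (x, z), m1 (y, z))"
      "\<And>x y z. x \<in> X \<Longrightarrow> y \<in> X \<Longrightarrow> z \<in> X \<Longrightarrow> m1 (m0 (x, y), z) = m0 (m1 (x, z), m1 (y, z))"
      "\<And>x y z. x \<in> X \<Longrightarrow> y \<in> X \<Longrightarrow> z \<in> X \<Longrightarrow> m0 (m1 (x, y), z) = m1 (m0 (x, z), m0 (y, z))"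
      using a by (simp_all add: e)
    have q: "m1 (m0 (m1 (m0 (x, y), z), u), v) =
        m1 (m0 (m1 (m0 (x, u), v), m1 (m0 (y, u), v)), m1 (m0 (z, u), v))"
      if "x \<in> X" "y \<in> X" "z \<in> X" "u \<in> X" "v \<in> X" for x y z u v
    proof -
      have "m1 (m0 (m1 (m0 (x, y), z), u), v) = m1 (m1 (m0 (m0 (x, u), m0 (y, u)), m0 (z, u)), v)"
        using that c d(1)[of x y u] d(4)[of "m0 (x, y)" z u] by simp
      also have "\<dots> = m1 (m1 (m0 (m0 (x, u), m0 (y, u)), v), m1 (m0 (z, u), v))"
        by (intro d(2) c that)
      also have "m1 (m0 (m0 (x, u), m0 (y, u)), v) = m0 (m1 (m0 (x, u), v), m1 (m0 (y, u), v))"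
        by (intro d(3) c that)
      finally show ?thesis .
    qed
    show ?thesis
      unfolding e F_obj.simps is_ternary_rack.simps
      by (intro conjI ballI;
          ((rule bij; assumption) | (simp add: c; rule q; assumption) | (auto simp: c; fail)))
  qed
  show "ternary_rack_hom (F_obj A) (F_obj B) f"
    if "is_mutual_rack A" "is_mutual_rack B" "mutual_rack_hom A B f"
  proof -
    have "f \<in> X \<rightarrow>\<^sub>E Y" "\<And>a. a \<in> X \<Longrightarrow> f a \<in> Y" "\<And>a b. a \<in> X \<Longrightarrow> b \<in> X \<Longrightarrow> m0 (a, b) \<in> X"
      "\<And>a b. a \<in> X \<Longrightarrow> b \<in> X \<Longrightarrow> f (m0 (a, b)) = n0 (f a, f b)"
      "\<And>a b. a \<in> X \<Longrightarrow> b \<in> X \<Longrightarrow> f (m1 (a, b)) = n1 (f a, f b)"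
      using that by (auto simp: e)
    then show ?thesis by (simp add: e)
  qed
qed (fact is_category_RM[unfolded cat_RM_def] is_category_T[unfolded cat_T_def])+

lemma is_functor_G: "is_functor cat_TC cat_R functor_G"
  unfolding functor_G_def cat_TC_def cat_R_def
proof (rule is_functor_square)
  fix A B :: "'a set \<times> 'a tern \<times> 'a tern" and f
  obtain X m0 m1 Y n0 n1 where e: "A = (X, m0, m1)" "B = (Y, n0, n1)"
    by (metis prod.exhaust)
  show "f \<in> fst A \<rightarrow>\<^sub>E fst B" if "compatible_ternary_rack_hom A B f"
    using that by (simp add: e)
  show "fst (G_obj A) = fst A \<times> fst A" by (simp add: e)
  show "is_rack (G_obj A)" if a: "is_compatible_ternary_rack A"
  proof -
    have c: "m0 (a, b, c) \<in> X" "m1 (a, b, c) \<in> X" if "a \<in> X" "b \<in> X" "c \<in> X" for a b c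
      using a that by (auto simp: e)
    have bij: "bij_betw (\<lambda>x. (\<lambda>((x0, x1), y0, y1)\<in>(X \<times> X) \<times> X \<times> X. (m0 (x0, y0, y1), m1 (x1, y0, y1)))
        (x, (a, b))) (X \<times> X) (X \<times> X)" if "a \<in> X" "b \<in> X" for a b
      using a that by (intro bij_betw_square[of "\<lambda>x. m0 (x, a, b)" X "\<lambda>x. m1 (x, a, b)"]) (auto simp: e)
    have d: "\<And>x y0 y1 z0 z1. x \<in> X \<Longrightarrow> y0 \<in> X \<Longrightarrow> y1 \<in> X \<Longrightarrow> z0 \<in> X \<Longrightarrow> z1 \<in> X \<Longrightarrow>
        m0 (m0 (x, y0, y1), z0, z1) = m0 (m0 (x, z0, z1), m0 (y0, z0, z1), m1 (y1, z0, z1))"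
      "\<And>x y0 y1 z0 z1. x \<in> X \<Longrightarrow> y0 \<in> X \<Longrightarrow> y1 \<in> X \<Longrightarrow> z0 \<in> X \<Longrightarrow> z1 \<in> X \<Longrightarrow>
        m1 (m1 (x, y0, y1), z0, z1) = m1 (m1 (x, z0, z1), m0 (y0, z0, z1), m1 (y1, z0, z1))"
      using a unfolding e is_compatible_ternary_rack.simps by blast+
    show ?thesis
      unfolding e G_obj.simps is_rack.simps
      by (intro conjI ballI;
          ((elim SigmaE; hypsubst; rule bij; assumption) |
           (clarsimp simp: c; intro conjI; rule d; assumption) | (auto simp: c; fail)))
  qed
  show "rack_hom (G_obj A) (G_obj B) (restrict (map_prod f f) (fst A \<times> fst A))"
    if "is_compatible_ternary_rack A" "is_compatible_ternary_rack B" "compatible_ternary_rack_hom A B f"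
  proof -
    have "\<And>a. a \<in> X \<Longrightarrow> f a \<in> Y" "\<And>a b c. a \<in> X \<Longrightarrow> b \<in> X \<Longrightarrow> c \<in> X \<Longrightarrow> m0 (a, b, c) \<in> X"
      "\<And>a b c. a \<in> X \<Longrightarrow> b \<in> X \<Longrightarrow> c \<in> X \<Longrightarrow> m1 (a, b, c) \<in> X"
      "\<And>a b c. a \<in> X \<Longrightarrow> b \<in> X \<Longrightarrow> c \<in> X \<Longrightarrow> f (m0 (a, b, c)) = n0 (f a, f b, f c)"
      "\<And>a b c. a \<in> X \<Longrightarrow> b \<in> X \<Longrightarrow> c \<in> X \<Longrightarrow> f (m1 (a, b, c)) = n1 (f a, f b, f c)"
      using that by (auto simp: e)
    then show ?thesis by (auto simp: e)
  qed
qed (fact is_category_TC[unfolded cat_TC_def] is_category_R[unfolded cat_R_def])+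

lemma is_functor_DR: "is_functor cat_RM cat_R functor_DR"
  unfolding functor_DR_def cat_RM_def cat_R_def
proof (rule is_functor_square)
  fix A B :: "'a set \<times> 'a bin \<times> 'a bin" and f
  obtain X m0 m1 Y n0 n1 where e: "A = (X, m0, m1)" "B = (Y, n0, n1)"
    by (metis prod.exhaust)
  show "f \<in> fst A \<rightarrow>\<^sub>E fst B" if "mutual_rack_hom A B f"
    using that by (simp add: e)
  show "fst (DR_obj A) = fst A \<times> fst A" by (simp add: e)
  show "is_rack (DR_obj A)" if a: "is_mutual_rack A"
  proof -
    have c: "m0 (a, b) \<in> X" "m1 (a, b) \<in> X" if "a \<in> X" "b \<in> X" for a b
      using a that by (auto simp: e)
    have b: "bij_betw (\<lambda>x. m1 (m0 (x, a), b)) X X" if "a \<in> X" "b \<in> X" for a b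
      using a that bij_betw_trans[of "\<lambda>x. m0 (x, a)" X X "\<lambda>x. m1 (x, b)" X] by (simp add: e o_def)
    have bij: "bij_betw (\<lambda>x. (\<lambda>((x0, x1), y0, y1)\<in>(X \<times> X) \<times> X \<times> X.
        (m1 (m0 (x0, y0), y1), m1 (m0 (x1, y0), y1))) (x, (a, b))) (X \<times> X) (X \<times> X)"
      if "a \<in> X" "b \<in> X" for a b
      using b[OF that] b[OF that] by (rule bij_betw_square) (simp add: that)
    have d: "\<And>x y z. x \<in> X \<Longrightarrow> y \<in> X \<Longrightarrow> z \<in> X \<Longrightarrow> m0 (m0 (x, y), z) = m0 (m0 (x, z), m0 (y, z))"
      "\<And>x y z. x \<in> X \<Longrightarrow> y \<in> X \<Longrightarrow> z \<in> X \<Longrightarrow> m1 (m1 (x, y), z) = m1 (m1 (x, z), m1 (y, z))"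
      "\<And>x y z. x \<in> X \<Longrightarrow> y \<in> X \<Longrightarrow> z \<in> X \<Longrightarrow> m1 (m0 (x, y), z) = m0 (m1 (x, z), m1 (y, z))"
      "\<And>x y z. x \<in> X \<Longrightarrow> y \<in> X \<Longrightarrow> z \<in> X \<Longrightarrow> m0 (m1 (x, y), z) = m1 (m0 (x, z), m0 (y, z))"
      using a by (simp_all add: e)
    have q: "m1 (m0 (m1 (m0 (x, y), z), u), v) =
        m1 (m0 (m1 (m0 (x, u), v), m1 (m0 (y, u), v)), m1 (m0 (z, u), v))"
      if "x \<in> X" "y \<in> X" "z \<in> X" "u \<in> X" "v \<in> X" for x y z u v
    proof -
      have "m1 (m0 (m1 (m0 (x, y), z), u), v) = m1 (m1 (m0 (m0 (x, u), m0 (y, u)), m0 (z, u)), v)"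
        using that c d(1)[of x y u] d(4)[of "m0 (x, y)" z u] by simp
      also have "\<dots> = m1 (m1 (m0 (m0 (x, u), m0 (y, u)), v), m1 (m0 (z, u), v))"
        by (intro d(2) c that)
      also have "m1 (m0 (m0 (x, u), m0 (y, u)), v) = m0 (m1 (m0 (x, u), v), m1 (m0 (y, u), v))"
        by (intro d(3) c that)
      finally show ?thesis .
    qed
    show ?thesis
      unfolding e DR_obj.simps is_rack.simps
      by (intro conjI ballI;
          ((elim SigmaE; hypsubst; rule bij; assumption) |
           (clarsimp simp: c; intro conjI; rule q; assumption) | (auto simp: c; fail)))
  qed
  show "rack_hom (DR_obj A) (DR_obj B) (restrict (map_prod f f) (fst A \<times> fst A))"
    if "is_mutual_rack A" "is_mutual_rack B" "mutual_rack_hom A B f"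
  proof -
    have "\<And>a. a \<in> X \<Longrightarrow> f a \<in> Y" "\<And>a b. a \<in> X \<Longrightarrow> b \<in> X \<Longrightarrow> m0 (a, b) \<in> X"
      "\<And>a b. a \<in> X \<Longrightarrow> b \<in> X \<Longrightarrow> m1 (a, b) \<in> X"
      "\<And>a b. a \<in> X \<Longrightarrow> b \<in> X \<Longrightarrow> f (m0 (a, b)) = n0 (f a, f b)"
      "\<And>a b. a \<in> X \<Longrightarrow> b \<in> X \<Longrightarrow> f (m1 (a, b)) = n1 (f a, f b)"
      using that by (auto simp: e)
    then show ?thesis by (auto simp: e)
  qed
qed (fact is_category_RM[unfolded cat_RM_def] is_category_R[unfolded cat_R_def])+

lemma is_functor_DT: "is_functor cat_TC cat_T functor_DT"
  unfolding functor_DT_def cat_TC_def cat_T_def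
proof (rule is_functor_square)
  fix A B :: "'a set \<times> 'a tern \<times> 'a tern" and f
  obtain X m0 m1 Y n0 n1 where e: "A = (X, m0, m1)" "B = (Y, n0, n1)"
    by (metis prod.exhaust)
  show "f \<in> fst A \<rightarrow>\<^sub>E fst B" if "compatible_ternary_rack_hom A B f"
    using that by (simp add: e)
  show "fst (DT_obj A) = fst A \<times> fst A" by (simp add: e)
  show "is_ternary_rack (DT_obj A)" if a: "is_compatible_ternary_rack A"
  proof -
    have c: "m0 (a, b, c) \<in> X" "m1 (a, b, c) \<in> X" if "a \<in> X" "b \<in> X" "c \<in> X" for a b c
      using a that by (auto simp: e)
    have b: "bij_betw (\<lambda>x. m0 (m0 (x, a, b), c, d)) X X" "bij_betw (\<lambda>x. m1 (m1 (x, a, b), c, d)) X X"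
      if "a \<in> X" "b \<in> X" "c \<in> X" "d \<in> X" for a b c d
      using a that bij_betw_trans[of "\<lambda>x. m0 (x, a, b)" X X "\<lambda>x. m0 (x, c, d)" X]
        bij_betw_trans[of "\<lambda>x. m1 (x, a, b)" X X "\<lambda>x. m1 (x, c, d)" X] by (simp_all add: e o_def)
    have bij: "bij_betw (\<lambda>x. (\<lambda>((x0, x1), (y0, y1), z0, z1)\<in>(X \<times> X) \<times> (X \<times> X) \<times> X \<times> X.
        (m0 (m0 (x0, y0, y1), z0, z1), m1 (m1 (x1, y0, y1), z0, z1))) (x, (a, b), (c, d)))
        (X \<times> X) (X \<times> X)" if "a \<in> X" "b \<in> X" "c \<in> X" "d \<in> X" for a b c d
      using b[OF that] by (rule bij_betw_square) (simp add: that)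
    have d: "\<And>x y0 y1 z0 z1. x \<in> X \<Longrightarrow> y0 \<in> X \<Longrightarrow> y1 \<in> X \<Longrightarrow> z0 \<in> X \<Longrightarrow> z1 \<in> X \<Longrightarrow>
        m0 (m0 (x, y0, y1), z0, z1) = m0 (m0 (x, z0, z1), m0 (y0, z0, z1), m1 (y1, z0, z1))"
      "\<And>x y0 y1 z0 z1. x \<in> X \<Longrightarrow> y0 \<in> X \<Longrightarrow> y1 \<in> X \<Longrightarrow> z0 \<in> X \<Longrightarrow> z1 \<in> X \<Longrightarrow>
        m1 (m1 (x, y0, y1), z0, z1) = m1 (m1 (x, z0, z1), m0 (y0, z0, z1), m1 (y1, z0, z1))"
      using a unfolding e is_compatible_ternary_rack.simps by blast+
    have h0: "m0 (m0 (m0 (x, y0, y1), z0, z1), u0, u1) =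
        m0 (m0 (m0 (x, u0, u1), m0 (y0, u0, u1), m1 (y1, u0, u1)), m0 (z0, u0, u1), m1 (z1, u0, u1))"
      if "x \<in> X" "y0 \<in> X" "y1 \<in> X" "z0 \<in> X" "z1 \<in> X" "u0 \<in> X" "u1 \<in> X" for x y0 y1 z0 z1 u0 u1
      using that c d(1)[of "m0 (x, y0, y1)" z0 z1 u0 u1] d(1)[of x y0 y1 u0 u1] by simp
    have h1: "m1 (m1 (m1 (x, y0, y1), z0, z1), u0, u1) =
        m1 (m1 (m1 (x, u0, u1), m0 (y0, u0, u1), m1 (y1, u0, u1)), m0 (z0, u0, u1), m1 (z1, u0, u1))"
      if "x \<in> X" "y0 \<in> X" "y1 \<in> X" "z0 \<in> X" "z1 \<in> X" "u0 \<in> X" "u1 \<in> X" for x y0 y1 z0 z1 u0 u1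
      using that c d(2)[of "m1 (x, y0, y1)" z0 z1 u0 u1] d(2)[of x y0 y1 u0 u1] by simp
    have d0: "m0 (m0 (m0 (m0 (x, y0, y1), z0, z1), u0, u1), v0, v1) =
        m0 (m0 (m0 (m0 (x, u0, u1), v0, v1), m0 (m0 (y0, u0, u1), v0, v1), m1 (m1 (y1, u0, u1), v0, v1)),
          m0 (m0 (z0, u0, u1), v0, v1), m1 (m1 (z1, u0, u1), v0, v1))"
      if "x \<in> X" "y0 \<in> X" "y1 \<in> X" "z0 \<in> X" "z1 \<in> X" "u0 \<in> X" "u1 \<in> X" "v0 \<in> X" "v1 \<in> X"
      for x y0 y1 z0 z1 u0 u1 v0 v1
      using that c h0[of x y0 y1 z0 z1 u0 u1]
        h0[of "m0 (x, u0, u1)" "m0 (y0, u0, u1)" "m1 (y1, u0, u1)" "m0 (z0, u0, u1)" "m1 (z1, u0, u1)" v0 v1]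
      by simp
    have d1: "m1 (m1 (m1 (m1 (x, y0, y1), z0, z1), u0, u1), v0, v1) =
        m1 (m1 (m1 (m1 (x, u0, u1), v0, v1), m0 (m0 (y0, u0, u1), v0, v1), m1 (m1 (y1, u0, u1), v0, v1)),
          m0 (m0 (z0, u0, u1), v0, v1), m1 (m1 (z1, u0, u1), v0, v1))"
      if "x \<in> X" "y0 \<in> X" "y1 \<in> X" "z0 \<in> X" "z1 \<in> X" "u0 \<in> X" "u1 \<in> X" "v0 \<in> X" "v1 \<in> X"
      for x y0 y1 z0 z1 u0 u1 v0 v1
      using that c h1[of x y0 y1 z0 z1 u0 u1]
        h1[of "m1 (x, u0, u1)" "m0 (y0, u0, u1)" "m1 (y1, u0, u1)" "m0 (z0, u0, u1)" "m1 (z1, u0, u1)" v0 v1]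
      by simp
    show ?thesis
      unfolding e DT_obj.simps is_ternary_rack.simps
      by (intro conjI ballI;
          ((elim SigmaE; hypsubst; rule bij; assumption) |
           (clarsimp simp: c; intro conjI; rule d0 d1; assumption) | (auto simp: c; fail)))
  qed
  show "ternary_rack_hom (DT_obj A) (DT_obj B) (restrict (map_prod f f) (fst A \<times> fst A))"
    if "is_compatible_ternary_rack A" "is_compatible_ternary_rack B" "compatible_ternary_rack_hom A B f"
  proof -
    have "\<And>a. a \<in> X \<Longrightarrow> f a \<in> Y" "\<And>a b c. a \<in> X \<Longrightarrow> b \<in> X \<Longrightarrow> c \<in> X \<Longrightarrow> m0 (a, b, c) \<in> X"
      "\<And>a b c. a \<in> X \<Longrightarrow> b \<in> X \<Longrightarrow> c \<in> X \<Longrightarrow> m1 (a, b, c) \<in> X"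
      "\<And>a b c. a \<in> X \<Longrightarrow> b \<in> X \<Longrightarrow> c \<in> X \<Longrightarrow> f (m0 (a, b, c)) = n0 (f a, f b, f c)"
      "\<And>a b c. a \<in> X \<Longrightarrow> b \<in> X \<Longrightarrow> c \<in> X \<Longrightarrow> f (m1 (a, b, c)) = n1 (f a, f b, f c)"
      using that by (auto simp: e)
    then show ?thesis by (auto simp: e)
  qed
qed (fact is_category_TC[unfolded cat_TC_def] is_category_T[unfolded cat_T_def])+

lemma is_functor_double_T: "is_functor cat_T cat_TC double_T"
  unfolding double_T_def cat_T_def cat_TC_def
  by (rule is_functor_same)
    (use is_category_T is_category_TC in \<open>auto simp: cat_T_def cat_TC_def\<close>)

lemma is_functor_double_R: "is_functor cat_R cat_RM double_R"
  unfolding double_R_def cat_R_def cat_RM_def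
  by (rule is_functor_same)
    (use is_category_R is_category_RM in \<open>auto simp: cat_R_def cat_RM_def\<close>)

end

theory Submission imports Defs begin

text \<open>Both identities come from substituting one defining formula into another. Doubling
  \<open>T(x,y,z) = (x *0 y) *1 z\<close> and applying the formula of \<open>G_obj\<close> gives the
  operation of \<open>DR_obj\<close>. Iterating the operation of \<open>G_obj\<close> as
  \<open>(x * y) * z\<close> gives, coordinate by coordinate, the operation of
  \<open>DT_obj\<close>. On arrows both sides carry the same endpoints and the same map
  \<open>f \<times> f\<close>. What remains is bookkeeping with restricted functions.
  \<open>mk_functor_comp3\<close> collapses a threefold composite to plain composition of the
  unrestricted maps; \<open>G_double_F_obj\<close> and \<open>F_double_G_obj\<close> compare
  objects; \<open>mk_functor_cong\<close> reduces equality of functors to agreement on the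
  source.\<close>

lemma mk_functor_cong:
  assumes "\<And>X. X \<in> Obj C \<Longrightarrow> Fo X = Go X" and "\<And>f. f \<in> Arr C \<Longrightarrow> Fa f = Ga f"
  shows "mk_functor C D Fo Fa = mk_functor C D Go Ga"
proof -
  have "restrict Fo (Obj C) = restrict Go (Obj C)"
    using assms(1) by (rule restrict_ext)
  moreover have "restrict Fa (Arr C) = restrict Ga (Arr C)"
    using assms(2) by (rule restrict_ext)
  ultimately show ?thesis
    by (simp only: mk_functor_def)
qed

text \<open>Functoriality of the inner functor places its values in the objects and arrows of
  \<open>D\<close>, where the restrictions built into the outer functor have no effect.\<close>

lemma mk_functor_comp:
  assumes "is_functor C D (mk_functor C D Fo Fa)"
  shows "mk_functor D E Go Ga \<circ>\<^sub>F mk_functor C D Fo Fa = mk_functor C E (Go \<circ> Fo) (Ga \<circ> Fa)"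
proof -
  have "restrict Fo (Obj C) \<in> Obj C \<rightarrow>\<^sub>E Obj D" "restrict Fa (Arr C) \<in> Arr C \<rightarrow>\<^sub>E Arr D"
    using assms unfolding is_functor_def mk_functor_def cfunctor.simps by blast+
  note this[THEN PiE_mem]
  then have "X \<in> Obj C \<Longrightarrow> Fo X \<in> Obj D" "f \<in> Arr C \<Longrightarrow> Fa f \<in> Arr D" for X f
    by (simp_all only: restrict_apply')
  then show ?thesis
    unfolding functor_comp_def mk_functor_def[of D] mk_functor_def[of C D] cfunctor.simps
    by (intro mk_functor_cong) (simp_all only: o_apply restrict_apply')
qed

lemma mk_functor_comp3:
  assumes "is_functor C D (mk_functor C D Fo Fa)" and "is_functor D E (mk_functor D E Go Ga)"
  shows "mk_functor E K Ho Ha \<circ>\<^sub>F mk_functor D E Go Ga \<circ>\<^sub>F mk_functor C D Fo Fa =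
    mk_functor C K (Ho \<circ> Go \<circ> Fo) (Ha \<circ> Ga \<circ> Fa)"
  by (simp only: mk_functor_comp assms)

text \<open>The restricted ternary operation is evaluated only at triples of elements of
  \<open>X\<close>, so its restriction vanishes at once.\<close>

lemma G_double_F_obj: "G_obj (double_op (F_obj A)) = DR_obj A"
proof -
  obtain X m0 m1 where A: "A = (X, m0, m1)" by (rule prod_cases3)
  show ?thesis
    unfolding A F_obj.simps double_op.simps G_obj.simps DR_obj.simps prod.inject
    by (intro conjI refl restrict_ext) (elim SigmaE; simp)
qed

text \<open>Here the restricted operation on \<open>X \<times> X\<close> is applied to its own
  output. Closure of \<open>T0\<close> and \<open>T1\<close> keeps that output in
  \<open>X \<times> X\<close>, so the outer application also unfolds.\<close>

lemma F_double_G_obj: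
  assumes "is_compatible_ternary_rack A"
  shows "F_obj (double_op (G_obj A)) = DT_obj A"
proof -
  obtain X T0 T1 where A: "A = (X, T0, T1)" by (rule prod_cases3)
  have "is_ternary_rack (X, T0)" "is_ternary_rack (X, T1)"
    using assms by (simp_all only: A is_compatible_ternary_rack.simps)
  note closed = this[THEN tern_closed]
  show ?thesis
    unfolding A F_obj.simps double_op.simps G_obj.simps DT_obj.simps prod.inject
    by (intro conjI refl restrict_ext) (elim SigmaE; simp add: closed)
qed

lemma fst_F_obj: "fst (F_obj A) = fst A"
  by (cases A) simp

lemma fst_double_op: "fst (double_op A) = fst A"
  by (cases A) simp

lemma functor_G_double_F: "functor_G \<circ>\<^sub>F double_T \<circ>\<^sub>F functor_F = functor_DR"
  unfolding functor_G_def double_T_def functor_F_def functor_DR_def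
    mk_functor_comp3[OF is_functor_F[unfolded functor_F_def] is_functor_double_T[unfolded double_T_def]]
proof (rule mk_functor_cong)
  fix f :: "('a, 'a bin \<times> 'a bin) arr"
  obtain A B h where "f = (A, B, h)" by (rule prod_cases3)
  \<comment> \<open>\<open>arr_square\<close> cuts \<open>h \<times> h\<close> down to the square of
    the carrier it sees, which is that of \<open>double_op (F_obj A)\<close>; this is the carrier of
    \<open>A\<close>.\<close>
  then show "(arr_square G_obj \<circ> arr_same double_op \<circ> arr_same F_obj) f = arr_square DR_obj f"
    by (simp only: o_apply arr_square_def arr_same_def prod.case G_double_F_obj fst_F_obj fst_double_op)
qed (simp only: o_apply G_double_F_obj)

lemma functor_F_double_G: "functor_F \<circ>\<^sub>F double_R \<circ>\<^sub>F functor_G = functor_DT"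
  unfolding functor_G_def double_R_def functor_F_def functor_DT_def
    mk_functor_comp3[OF is_functor_G[unfolded functor_G_def] is_functor_double_R[unfolded double_R_def]]
proof (rule mk_functor_cong)
  fix A :: "'a set \<times> 'a tern \<times> 'a tern"
  assume "A \<in> Obj cat_TC"
  then have "is_compatible_ternary_rack A"
    by (simp only: cat_TC_def concrete_category_def category.simps mem_Collect_eq)
  then show "(F_obj \<circ> double_op \<circ> G_obj) A = DT_obj A"
    by (simp only: o_apply F_double_G_obj)
next
  fix f :: "('a, 'a tern \<times> 'a tern) arr"
  assume f: "f \<in> Arr cat_TC"
  obtain A B h where e: "f = (A, B, h)" by (rule prod_cases3)
  \<comment> \<open>An arrow records both endpoints, so the object identity is applied to domain and
    codomain alike.\<close>
  have "is_compatible_ternary_rack A" "is_compatible_ternary_rack B"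
    using f by (simp_all only: e cat_TC_def concrete_category_def category.simps mem_Collect_eq prod.case)
  then show "(arr_same F_obj \<circ> arr_same double_op \<circ> arr_square G_obj) f = arr_square DT_obj f"
    by (simp only: e o_apply arr_square_def arr_same_def prod.case F_double_G_obj)
qed

theorem proposition7p7:
  shows "functor_G \<circ>\<^sub>F double_T \<circ>\<^sub>F functor_F = functor_DR \<and>
         functor_F \<circ>\<^sub>F double_R \<circ>\<^sub>F functor_G = functor_DT"
  by (rule conjI[OF functor_G_double_F functor_F_double_G])

end
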